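(* Let $(\mathcal{X},\mathcal{F},\mathcal{P})$ be a statistical model, let $\mathcal{M}$ be a finite index set, and for each $\mathbf{P}\in\mathcal{P}$ let $\mathcal{M}_0(\mathbf{P}),\mathcal{M}_1(\mathbf{P})$ be disjoint subsets of $\mathcal{M}$ with union $\mathcal{M}$. Let $\mathbf{\Delta}=(\Delta_m: m\in\mathcal{M})$, $\Delta_m=\{\delta_m(\alpha):\alpha\in[0,1]\}$, be an $\mathcal{M}$-indexed multiple decision process satisfying conditions (D1)--(D4) listed in the context, and let $\mathbf{A}=(A_m: m\in\mathcal{M})$ be an $\mathcal{M}$-indexed collection of measurable functions $A_m:[0,1]\to[0,1]$ satisfying conditions (A1)--(A4) listed in the context. Assume that the generalized $P$-value statistics $\alpha_m=\inf\{\alpha\in[0,1]:\delta_m(A_m(\alpha))=1\}$, $m\in\mathcal{M}$, are almost surely pairwise distinct under every $\mathbf{P}\in\mathcal{P}$. For $\alpha\in[0,1]$ and $\mathbf{P}\in\mathcal{P}$ let $$S_0(\alpha;\mathbf{P})=\sum_{m\in\mathcal{M}_0(\mathbf{P})}\delta_m(A_m(\alpha)),\qquad S(\alpha)=\sum_{m\in\mathcal{M}}\delta_m(A_m(\alpha)),\qquad F(\alpha;\mathbf{P})=\frac{S_0(\alpha;\mathbf{P})}{S(\alpha)}\,I\{S(\alpha)>0\},$$ with the convention $0/0=0$, and for $q\in[0,1]$ define the random variable $$\alpha^*(q)=\sup\Big\{\alpha\in[0,1]:\ \sum_{m\in\mathcal{M}}A_m(\alpha)\le q\,S(\alpha)\Big\}.$$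 Then for every $\mathbf{P}\in\mathcal{P}$ and every $q\in[0,1]$, $$E_{\mathbf{P}}\big\{F(\alpha^*(q);\mathbf{P})\big\}\le q,$$ that is, the multiple decision function $\big(\delta_m[A_m(\alpha^*(q))]: m\in\mathcal{M}\big)$ has false discovery rate at most $q$ under every $\mathbf{P}\in\mathcal{P}$.
   Context: $(\mathcal{X},\mathcal{F})$ is a measurable space and $\mathcal{P}$ is a collection of probability measures on it; $E_{\mathbf{P}}$ denotes expectation under $\mathbf{P}$, $I\{\cdot\}$ is the indicator function, and "a.e.-$\mathcal{P}$" means almost surely under every $\mathbf{P}\in\mathcal{P}$. A (nonrandomized) decision function is a measurable map $\delta:\mathcal{X}\to\{0,1\}$. For each $m\in\mathcal{M}$ and $\alpha\in[0,1]$, $\delta_m(\alpha)$ is a decision function, i.e. a $\{0,1\}$-valued random variable $x\mapsto\delta_m(x;\alpha)$ on $\mathcal{X}$; $\Delta_m=\{\delta_m(\alpha):\alpha\in[0,1]\}$ is viewed as a stochastic process in $\alpha$. In the multiple testing interpretation, the $m$th null hypothesis is true under $\mathbf{P}$ if and only if $m\in\mathcal{M}_0(\mathbf{P})$, and $\delta_m=1$ means that the $m$th null hypothesis is rejected. Conditions on $\mathbf{\Delta}$: (D1) For each $m\in\mathcal{M}$, $\delta_m(0)=0$ and $\delta_m(1)=1$ a.e.-$\mathcal{P}$. (D2) For each $m\in\mathcal{M}$, the sample paths $\alpha\mapsto\delta_m(\alpha)$ are, a.e.-$\mathcal{P}$, $\{0,1\}$-valued step functions which are nondecreasing and right-continuous.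 (D3) For each $\mathbf{P}\in\mathcal{P}$, under $\mathbf{P}$ the subcollections $\{\Delta_m: m\in\mathcal{M}_0(\mathbf{P})\}$ and $\{\Delta_m: m\in\mathcal{M}_1(\mathbf{P})\}$ are independent of each other, and the elements of $\{\Delta_m: m\in\mathcal{M}_0(\mathbf{P})\}$ are independent. (The elements of $\{\Delta_m: m\in\mathcal{M}_1(\mathbf{P})\}$ need not be independent of each other.) (D4) For all $\mathbf{P}\in\mathcal{P}$, all $m\in\mathcal{M}_0(\mathbf{P})$ and all $\alpha\in[0,1]$, $E_{\mathbf{P}}\{\delta_m(\alpha)\}=\alpha$. Conditions on $\mathbf{A}$ ((A1) and (A2) for each $m\in\mathcal{M}$): (A1) $A_m(0)=0$ and $A_m(1)=1$. (A2) The mapping $\alpha\mapsto A_m(\alpha)$ is continuous and strictly increasing on $[0,1]$. (A3) For all $\alpha\in[0,1]$, $\prod_{m\in\mathcal{M}}[1-A_m(\alpha)]\ge 1-\alpha$. (A4) For all $\alpha\in[0,1]$ and all $\mathbf{P}\in\mathcal{P}$, $|\mathcal{M}_0(\mathbf{P})|\,\max_{m\in\mathcal{M}_0(\mathbf{P})}A_m(\alpha)\le\sum_{m\in\mathcal{M}}A_m(\alpha)$ (the left side being read as $0$ if $\mathcal{M}_0(\mathbf{P})=\emptyset$). *)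

theory Defs
  imports "HOL-Probability.Probability"
begin

text \<open>
  A decision process is a function \<open>\<delta> :: 'm \<Rightarrow> real \<Rightarrow> 'x \<Rightarrow> real\<close>: \<open>\<delta> m \<alpha> x\<close> is the decision for the
  \<open>m\<close>th hypothesis at size \<open>\<alpha>\<close> when \<open>x\<close> is observed.  Decisions are the reals 0 and 1, and only the
  values at \<open>\<alpha> \<in> {0..1}\<close> are ever used; the same holds for the size functions \<open>A :: 'm \<Rightarrow> real \<Rightarrow> real\<close>.
\<close>

definition step_on_unit :: "(real \<Rightarrow> real) \<Rightarrow> bool" where
  "step_on_unit f \<longleftrightarrow>
    (\<exists>D. finite D \<and> (\<forall>s\<in>{0..1}. \<forall>t\<in>{0..1}. s \<le> t \<longrightarrow> {s..t} \<inter> D = {} \<longrightarrow> f s = f t))"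

text \<open>The process \<open>\<Delta>\<^sub>m\<close> as a single random element: its path on \<open>{0..1}\<close>, with the product
  (cylinder) sigma-algebra, which makes independence of the paths independence of the
  sigma-algebras generated by all the \<open>\<delta> m \<alpha>\<close>.\<close>

definition path_space :: "(real \<Rightarrow> real) measure" where
  "path_space = (\<Pi>\<^sub>M \<alpha>\<in>{0..1}. count_space {0, 1})"

definition decision_path :: "('m \<Rightarrow> real \<Rightarrow> 'x \<Rightarrow> real) \<Rightarrow> 'm \<Rightarrow> 'x \<Rightarrow> real \<Rightarrow> real" where
  "decision_path \<delta> m x = (\<lambda>\<alpha>\<in>{0..1}. \<delta> m \<alpha> x)"

definition decision_paths :: "('m \<Rightarrow> real \<Rightarrow> 'x \<Rightarrow> real) \<Rightarrow> 'm set \<Rightarrow> 'x \<Rightarrow> 'm \<Rightarrow> real \<Rightarrow> real" where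
  "decision_paths \<delta> J x = (\<lambda>m\<in>J. decision_path \<delta> m x)"

definition pvalue :: "('m \<Rightarrow> real \<Rightarrow> real) \<Rightarrow> ('m \<Rightarrow> real \<Rightarrow> 'x \<Rightarrow> real) \<Rightarrow> 'm \<Rightarrow> 'x \<Rightarrow> real" where
  "pvalue A \<delta> m x = Inf {\<alpha> \<in> {0..1}. \<delta> m (A m \<alpha>) x = 1}"

text \<open>The number of rejections among the hypotheses in \<open>J\<close>: \<open>S\<close> for \<open>J = M\<close>, and \<open>S\<^sub>0\<close> for the
  set \<open>J\<close> of true null hypotheses.\<close>

definition rejections ::
  "('m \<Rightarrow> real \<Rightarrow> real) \<Rightarrow> ('m \<Rightarrow> real \<Rightarrow> 'x \<Rightarrow> real) \<Rightarrow> 'm set \<Rightarrow> real \<Rightarrow> 'x \<Rightarrow> real" where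
  "rejections A \<delta> J \<alpha> x = (\<Sum>m\<in>J. \<delta> m (A m \<alpha>) x)"

definition false_discovery_prop ::
  "('m \<Rightarrow> real \<Rightarrow> real) \<Rightarrow> ('m \<Rightarrow> real \<Rightarrow> 'x \<Rightarrow> real) \<Rightarrow> 'm set \<Rightarrow> 'm set \<Rightarrow> real \<Rightarrow> 'x \<Rightarrow> real" where
  "false_discovery_prop A \<delta> M N \<alpha> x =
    rejections A \<delta> N \<alpha> x / rejections A \<delta> M \<alpha> x * of_bool (rejections A \<delta> M \<alpha> x > 0)"

definition alpha_star ::
  "('m \<Rightarrow> real \<Rightarrow> real) \<Rightarrow> ('m \<Rightarrow> real \<Rightarrow> 'x \<Rightarrow> real) \<Rightarrow> 'm set \<Rightarrow> real \<Rightarrow> 'x \<Rightarrow> real" where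
  "alpha_star A \<delta> M q x =
    Sup {\<alpha> \<in> {0..1}. (\<Sum>m\<in>M. A m \<alpha>) \<le> q * rejections A \<delta> M \<alpha> x}"

text \<open>The false discovery proportion at the random size \<open>\<alpha>\<^sup>*(q)\<close>, as a function of \<open>x\<close>; its
  expectation under \<open>P\<close> is the false discovery rate.  The paths of \<open>\<delta>\<close> are regular only almost
  surely, so this function is in general only \<open>P\<close>-almost everywhere equal to a measurable one.  Its
  expectation under \<open>P\<close> is therefore to be taken in \<^term>\<open>completion P\<close>, where the integral agrees
  with the one under \<open>P\<close> for \<open>P\<close>-measurable functions; the Bochner integral under \<open>P\<close> itself would be
  the default value 0 if measurability failed.\<close>

definition fdp_star ::
  "('m \<Rightarrow> real \<Rightarrow> real) \<Rightarrow> ('m \<Rightarrow> real \<Rightarrow> 'x \<Rightarrow> real) \<Rightarrow> 'm set \<Rightarrow> 'm set \<Rightarrow> real \<Rightarrow> 'x \<Rightarrow> real" where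
  "fdp_star A \<delta> M N q x = false_discovery_prop A \<delta> M N (alpha_star A \<delta> M q x) x"

end

theory Submission imports Defs begin

text \<open>
  Write \<open>B \<alpha> = (\<Sum>m\<in>M. A m \<alpha>)\<close>.  Since \<open>S\<close> takes only the values \<open>0, \<dots>, n = |M|\<close>, the random size
  \<open>\<alpha>\<^sup>*(q)\<close> is one of the finitely many deterministic levels \<open>max {\<alpha>. B \<alpha> \<le> q k}\<close>, \<open>k \<le> n\<close>, or 0, and \<open>B (\<alpha>\<^sup>*) \<le> q S(\<alpha>\<^sup>*)\<close>.  Fix a true null \<open>m\<close> and let \<open>R\<close> be \<open>S\<close> with \<open>\<delta> m\<close> replaced
  by 1, and \<open>\<beta>\<close> the size obtained from \<open>R\<close> in place of \<open>S\<close>.  If \<open>m\<close> is rejected at \<open>\<alpha>\<^sup>*\<close>, then \<open>R\<close>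
  and \<open>S\<close> agree from \<open>\<alpha>\<^sup>*\<close> on, so \<open>\<beta> = \<alpha>\<^sup>*\<close>.  As \<open>(\<beta>, R)\<close> is independent of \<open>\<delta> m\<close>, the contribution of
  \<open>m\<close> to the false discovery rate is at most \<open>E (A m \<beta> / R \<beta>)\<close>, which (A4) and \<open>B \<beta> \<le> q R \<beta>\<close> bound
  by \<open>q / |M\<^sub>0|\<close>; sum over the true nulls.
\<close>

section \<open>Almost everywhere equality and independence\<close>

text \<open>Preimages under \<open>f\<close> and \<open>g\<close> differ only by a null set, and
  completeness makes every such modification measurable. This transfers measurability to
  \<open>fdp_star\<close>, whose regularity holds only almost everywhere.\<close>

lemma (in complete_measure) measurable_cong_AE:
  assumes f: "f \<in> M \<rightarrow>\<^sub>M N" and g: "g \<in> space M \<rightarrow> space N" and eq: "AE x in M. f x = g x"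
  shows "g \<in> M \<rightarrow>\<^sub>M N"
proof (rule measurableI)
  show "g x \<in> space N" if "x \<in> space M" for x
    using g that by auto
  fix S assume S: "S \<in> sets N"
  show "g -` S \<inter> space M \<in> sets M"
  proof (rule in_sets_AE)
    show "AE x in M. x \<in> f -` S \<inter> space M \<longleftrightarrow> x \<in> g -` S \<inter> space M"
      using eq by eventually_elim auto
    show "f -` S \<inter> space M \<in> sets M"
      using f S by (rule measurable_sets)
  qed auto
qed

text \<open>The two hypotheses make \<open>f Z\<close>, \<open>g Z\<close> and \<open>V\<close>
  mutually independent: \<open>V\<close> splits off from \<open>Z\<close>, then \<open>f Z\<close>
  from \<open>g Z\<close>. Grouping the last two variables keeps the pair independent of the
  first.\<close>

lemma (in prob_space) indep_var_combine:
  fixes F :: "'b \<Rightarrow> real"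
  assumes XY: "indep_var MA (\<lambda>x. f (Z x)) MB (\<lambda>x. g (Z x))"
    and ZV: "indep_var MZ Z MD V"
    and f: "f \<in> MZ \<rightarrow>\<^sub>M MA" and g: "g \<in> MZ \<rightarrow>\<^sub>M MB"
    and F: "F \<in> borel_measurable MA" and H: "H \<in> borel_measurable (MB \<Otimes>\<^sub>M MD)"
  shows "indep_var borel (\<lambda>x. F (f (Z x))) borel (\<lambda>x. H (g (Z x), V x))"
proof -
  define X where "X x = f (Z x)" for x
  define Y where "Y x = g (Z x)" for x
  note XY = XY[folded X_def Y_def]
  note f [measurable] g [measurable]
  note rv [measurable] = indep_var_rv1[OF XY] indep_var_rv2[OF XY] indep_var_rv2[OF ZV] indep_var_rv1[OF ZV]
  have Ysp: "Y x \<in> space MB" and Vsp: "V x \<in> space MD" and Zsp: "Z x \<in> space MZ" if "x \<in> space M" for x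
    using measurable_space[OF rv(2) that] measurable_space[OF rv(3) that] measurable_space[OF rv(4) that] .
  \<comment> \<open>Both families are closed under intersection, so it suffices to check
    independence on them and extend it to the generated sigma-algebras. For the pair
    \<open>(Y, V)\<close> only rectangles are taken.\<close>
  define A0 where "A0 = {X -` S \<inter> space M | S. S \<in> sets MA}"
  define B0 where "B0 = {Y -` S \<inter> V -` T \<inter> space M | S T. S \<in> sets MB \<and> T \<in> sets MD}"
  have indep: "indep_set A0 B0"
  proof (rule indep_setI)
    show "A0 \<subseteq> events"
      by (auto simp: A0_def)
    show "B0 \<subseteq> events"
    proof
      fix b assume "b \<in> B0"
      then obtain S T where b: "b = (Y -` S \<inter> space M) \<inter> (V -` T \<inter> space M)" and "S \<in> sets MB" "T \<in> sets MD"
        by (auto simp: B0_def)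
      then show "b \<in> events" unfolding b by (intro sets.Int measurable_sets[OF rv(2)] measurable_sets[OF rv(3)])
    qed
    fix a b assume "a \<in> A0" "b \<in> B0"
    then obtain S T U where a: "a = X -` S \<inter> space M" and b: "b = Y -` T \<inter> V -` U \<inter> space M"
      and STU: "S \<in> sets MA" "T \<in> sets MB" "U \<in> sets MD"
      by (auto simp: A0_def B0_def)
    have T: "g -` T \<inter> space MZ \<in> sets MZ" and S: "f -` S \<inter> space MZ \<in> sets MZ"
      using STU by auto
    then have ST: "(f -` S \<inter> space MZ) \<inter> (g -` T \<inter> space MZ) \<in> sets MZ" by auto
    \<comment> \<open>The events of \<open>X\<close> and \<open>Y\<close> are pulled back to one
      event of \<open>Z\<close>, so \<open>ZV\<close> splits off \<open>V\<close>; then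
      \<open>XY\<close> separates \<open>X\<close> from \<open>Y\<close>; finally \<open>ZV\<close>,
      read backwards, fuses \<open>Y\<close> and \<open>V\<close> into \<open>b\<close>.\<close>
    have "prob (a \<inter> b) = prob ((\<lambda>x. (Z x, V x)) -` (((f -` S \<inter> space MZ) \<inter> (g -` T \<inter> space MZ)) \<times> U) \<inter> space M)"
      by (rule arg_cong[where f=prob]) (auto simp: a b X_def Y_def dest: Zsp)
    also have "\<dots> = prob (Z -` ((f -` S \<inter> space MZ) \<inter> (g -` T \<inter> space MZ)) \<inter> space M) * prob (V -` U \<inter> space M)"
      using ST STU by (intro indep_varD[OF ZV])
    also have "Z -` ((f -` S \<inter> space MZ) \<inter> (g -` T \<inter> space MZ)) \<inter> space M = (\<lambda>x. (X x, Y x)) -` (S \<times> T) \<inter> space M"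
      by (auto simp: X_def Y_def dest: Zsp)
    also have "prob \<dots> = prob a * prob (Y -` T \<inter> space M)"
      using indep_varD[OF XY STU(1,2)] by (simp add: a)
    also have "\<dots> * prob (V -` U \<inter> space M) = prob a * (prob (Y -` T \<inter> space M) * prob (V -` U \<inter> space M))"
      by simp
    also have "Y -` T \<inter> space M = Z -` (g -` T \<inter> space MZ) \<inter> space M"
      by (auto simp: Y_def dest: Zsp)
    also have "prob \<dots> * prob (V -` U \<inter> space M)
        = prob ((\<lambda>x. (Z x, V x)) -` ((g -` T \<inter> space MZ) \<times> U) \<inter> space M)"
      using indep_varD[OF ZV T STU(3)] by simp
    also have "(\<lambda>x. (Z x, V x)) -` ((g -` T \<inter> space MZ) \<times> U) \<inter> space M = b"
      by (auto simp: b Y_def dest: Zsp)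
    finally show "prob (a \<inter> b) = prob a * prob b" .
  qed
  have A0: "Int_stable A0"
  proof (rule Int_stableI)
    fix a b assume "a \<in> A0" "b \<in> A0"
    then obtain S T where "a = X -` S \<inter> space M" "b = X -` T \<inter> space M" "S \<in> sets MA" "T \<in> sets MA"
      by (auto simp: A0_def)
    then have "a \<inter> b = X -` (S \<inter> T) \<inter> space M" "S \<inter> T \<in> sets MA" by auto
    then show "a \<inter> b \<in> A0" unfolding A0_def by blast
  qed
  have B0: "Int_stable B0"
  proof (rule Int_stableI)
    fix a b assume "a \<in> B0" "b \<in> B0"
    then obtain S T S' T' where "a = Y -` S \<inter> V -` T \<inter> space M" "b = Y -` S' \<inter> V -` T' \<inter> space M"
      "S \<in> sets MB" "S' \<in> sets MB" "T \<in> sets MD" "T' \<in> sets MD"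
      by (auto simp: B0_def)
    then have "a \<inter> b = Y -` (S \<inter> S') \<inter> V -` (T \<inter> T') \<inter> space M" "S \<inter> S' \<in> sets MB" "T \<inter> T' \<in> sets MD"
      by auto
    then show "a \<inter> b \<in> B0" unfolding B0_def by blast
  qed
  \<comment> \<open>\<open>Y\<close> and \<open>V\<close> are measurable for the sigma-algebra
    generated by \<open>B0\<close>, hence so is the pair, and every event of \<open>H (Y, V)\<close>
    lies in \<open>sigma_sets (space M) B0\<close>.\<close>
  define G where "G = sigma (space M) B0"
  have B0_Pow: "B0 \<subseteq> Pow (space M)" by (auto simp: B0_def)
  have G: "space G = space M" "sets G = sigma_sets (space M) B0"
    using B0_Pow by (simp_all add: G_def)
  have [measurable]: "Y \<in> G \<rightarrow>\<^sub>M MB"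
  proof (rule measurableI)
    fix S assume "S \<in> sets MB"
    then have "Y -` S \<inter> V -` space MD \<inter> space M \<in> B0" unfolding B0_def by blast
    moreover have "Y -` S \<inter> V -` space MD \<inter> space M = Y -` S \<inter> space G"
      using Vsp by (auto simp: G)
    ultimately show "Y -` S \<inter> space G \<in> sets G" by (auto simp: G)
  qed (use Ysp in \<open>auto simp: G\<close>)
  have [measurable]: "V \<in> G \<rightarrow>\<^sub>M MD"
  proof (rule measurableI)
    fix S assume "S \<in> sets MD"
    then have "Y -` space MB \<inter> V -` S \<inter> space M \<in> B0" unfolding B0_def by blast
    moreover have "Y -` space MB \<inter> V -` S \<inter> space M = V -` S \<inter> space G"
      using Ysp by (auto simp: G)
    ultimately show "V -` S \<inter> space G \<in> sets G" by (auto simp: G)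
  qed (use Vsp in \<open>auto simp: G\<close>)
  have YVG: "(\<lambda>x. (Y x, V x)) \<in> G \<rightarrow>\<^sub>M MB \<Otimes>\<^sub>M MD" by measurable
  have HG: "(\<lambda>x. H (Y x, V x)) \<in> borel_measurable G"
    using measurable_compose[OF YVG H] .
  have HM: "(\<lambda>x. H (Y x, V x)) \<in> borel_measurable M"
    using H by measurable
  have FM: "(\<lambda>x. F (X x)) \<in> borel_measurable M"
    using F by measurable
  have "(\<lambda>x. F (X x)) -` S \<inter> space M \<in> A0" if "S \<in> sets borel" for S
  proof -
    have "(\<lambda>x. F (X x)) -` S \<inter> space M = X -` (F -` S \<inter> space MA) \<inter> space M"
      using measurable_space[OF rv(1)] by auto
    then show ?thesis using measurable_sets[OF F that] unfolding A0_def by blast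
  qed
  then have subA: "{(\<lambda>x. F (X x)) -` S \<inter> space M |S. S \<in> sets borel} \<subseteq> sigma_sets (space M) A0"
    by (auto intro: sigma_sets.Basic)
  have subB: "{(\<lambda>x. H (Y x, V x)) -` S \<inter> space M |S. S \<in> sets borel} \<subseteq> sigma_sets (space M) B0"
    using measurable_sets[OF HG] by (auto simp: G)
  have "indep_set (sigma_sets (space M) {(\<lambda>x. F (X x)) -` S \<inter> space M |S. S \<in> sets borel})
      (sigma_sets (space M) {(\<lambda>x. H (Y x, V x)) -` S \<inter> space M |S. S \<in> sets borel})"
    using indep_set_sigma_sets[OF indep A0 B0] unfolding indep_set_def
    by (rule indep_sets_mono_sets)
       (use sigma_sets_mono[OF subA] sigma_sets_mono[OF subB] in \<open>auto split: bool.split\<close>)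
  then show ?thesis
    using FM HM by (simp add: indep_var_eq X_def Y_def)
qed

section \<open>Step-up levels as finite maxima\<close>

text \<open>The supremum in \<open>alpha_star\<close> with the random count frozen at a constant
  \<open>k\<close>, hence a deterministic level.\<close>

definition crossing :: "(real \<Rightarrow> real) \<Rightarrow> real \<Rightarrow> nat \<Rightarrow> real" where
  "crossing B q k = Sup {\<alpha> \<in> {0..1}. B \<alpha> \<le> q * real k}"

text \<open>A substitute for the supremum over a continuum: it reads \<open>s\<close> at finitely
  many fixed levels only, which makes it measurable in a random \<open>s\<close>. The default 0 is
  harmless, since 0 satisfies the constraint when \<open>B 0 = 0\<close>, \<open>0 \<le> q\<close>
  and \<open>0 \<le> s 0\<close>.\<close>

definition step_up :: "(real \<Rightarrow> real) \<Rightarrow> real \<Rightarrow> nat \<Rightarrow> (real \<Rightarrow> real) \<Rightarrow> real" where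
  "step_up B q n s = (MAX k\<in>{..n}. if real k \<le> s (crossing B q k) then crossing B q k else 0)"

lemma le_crossing:
  assumes "\<alpha> \<in> {0..1}" "B \<alpha> \<le> q * real k"
  shows "\<alpha> \<le> crossing B q k"
  unfolding crossing_def using assms by (intro cSup_upper) (auto intro: bdd_aboveI[of _ 1])

lemma crossing_mem:
  assumes B: "continuous_on {0..1} B" "B 0 = 0" and q: "0 \<le> q"
  shows "crossing B q k \<in> {0..1}" "B (crossing B q k) \<le> q * real k"
proof -
  have "closed {\<alpha> \<in> {0..1}. B \<alpha> \<le> q * real k}"
    using B by (intro continuous_closed_preimage_constant continuous_on_closed_Collect_le) auto
  moreover have "{\<alpha> \<in> {0..1}. B \<alpha> \<le> q * real k} \<noteq> {}"
    using B q by (auto intro!: exI[of _ 0])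
  moreover have "bdd_above {\<alpha> \<in> {0..1}. B \<alpha> \<le> q * real k}"
    by (auto intro: bdd_aboveI[of _ 1])
  ultimately have "crossing B q k \<in> {\<alpha> \<in> {0..1}. B \<alpha> \<le> q * real k}"
    unfolding crossing_def by (intro closed_contains_Sup)
  then show "crossing B q k \<in> {0..1}" "B (crossing B q k) \<le> q * real k" by auto
qed

lemma measurable_step_up:
  assumes "\<And>k. k \<le> n \<Longrightarrow> (\<lambda>x. s x (crossing B q k)) \<in> borel_measurable N"
  shows "(\<lambda>x. step_up B q n (s x)) \<in> borel_measurable N"
  unfolding step_up_def
proof (rule borel_measurable_Max)
  fix k assume "k \<in> {..n}"
  then have [measurable]: "(\<lambda>x. s x (crossing B q k)) \<in> borel_measurable N"
    using assms by auto
  show "(\<lambda>x. if real k \<le> s x (crossing B q k) then crossing B q k else 0) \<in> borel_measurable N"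
    by measurable
qed simp

text \<open>Finitely many deterministic values: this later allows expectations to be split according
  to the value of the random size.\<close>

lemma step_up_range: "step_up B q n s \<in> insert 0 (crossing B q ` {..n})"
proof -
  have "step_up B q n s \<in> (\<lambda>k. if real k \<le> s (crossing B q k) then crossing B q k else 0) ` {..n}"
    unfolding step_up_def by (rule Max_in) auto
  then show ?thesis by auto
qed

context
  fixes B :: "real \<Rightarrow> real" and q :: real
  assumes B: "continuous_on {0..1} B" "B 0 = 0" and q: "0 \<le> q"
begin

lemma step_up_cong:
  assumes "\<And>\<alpha>. \<alpha> \<in> {0..1} \<Longrightarrow> s \<alpha> = s' \<alpha>"
  shows "step_up B q n s = step_up B q n s'"
  unfolding step_up_def using assms crossing_mem(1)[OF B q] by simp

text \<open>The maximum is attained, either at the default 0, where \<open>B\<close> vanishes, or at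
  a crossing level for some \<open>k\<close> with \<open>B\<close> at most \<open>q * k\<close> and
  \<open>k\<close> at most \<open>s\<close> there.\<close>

lemma step_up_mem:
  assumes s: "0 \<le> s 0"
  shows "step_up B q n s \<in> {0..1}" "B (step_up B q n s) \<le> q * s (step_up B q n s)"
proof -
  show "step_up B q n s \<in> {0..1}"
    using step_up_range[of B q n s] crossing_mem(1)[OF B q] by auto
  have "step_up B q n s \<in> (\<lambda>k. if real k \<le> s (crossing B q k) then crossing B q k else 0) ` {..n}"
    unfolding step_up_def by (rule Max_in) auto
  then obtain k where "step_up B q n s = (if real k \<le> s (crossing B q k) then crossing B q k else 0)"
    by (rule imageE)
  then show "B (step_up B q n s) \<le> q * s (step_up B q n s)"
    using B q s crossing_mem(2)[OF B q, of k]
    by (auto split: if_splits intro: order_trans mult_left_mono)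
qed

text \<open>With \<open>k\<close> the count at \<alpha>, the level \<open>crossing B q k\<close>
  lies at or above \<alpha>; by monotonicity the count there is still at least \<open>k\<close>, so
  this level enters the maximum.\<close>

lemma le_step_up:
  assumes s: "mono_on {0..1} s" and \<alpha>: "\<alpha> \<in> {0..1}" "B \<alpha> \<le> q * s \<alpha>" and k: "s \<alpha> = real k" "k \<le> n"
  shows "\<alpha> \<le> step_up B q n s"
proof -
  have le: "\<alpha> \<le> crossing B q k"
    using le_crossing \<alpha> k by metis
  with s \<alpha> crossing_mem(1)[OF B q] have "real k \<le> s (crossing B q k)"
    unfolding k(1)[symmetric] by (auto simp: mono_on_def)
  then have "crossing B q k = (if real k \<le> s (crossing B q k) then crossing B q k else 0)" by simp
  also have "\<dots> \<le> step_up B q n s"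
    unfolding step_up_def using k by (intro Max_ge) auto
  finally show ?thesis using le by simp
qed

text \<open>The finite maximum satisfies the constraint itself and dominates every level that does,
  so the supremum is attained there.\<close>

lemma Sup_eq_step_up:
  assumes s: "mono_on {0..1} s" and s_nat: "\<And>\<alpha>. \<alpha> \<in> {0..1} \<Longrightarrow> s \<alpha> \<in> real ` {..n}"
  shows "Sup {\<alpha> \<in> {0..1}. B \<alpha> \<le> q * s \<alpha>} = step_up B q n s"
proof (rule cSup_eq_maximum)
  have "0 \<le> s 0" using s_nat[of 0] by auto
  then show "step_up B q n s \<in> {\<alpha> \<in> {0..1}. B \<alpha> \<le> q * s \<alpha>}"
    using step_up_mem by auto
  fix \<alpha> assume "\<alpha> \<in> {\<alpha> \<in> {0..1}. B \<alpha> \<le> q * s \<alpha>}"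
  moreover from this obtain k where "s \<alpha> = real k" "k \<le> n" using s_nat[of \<alpha>] by auto
  ultimately show "\<alpha> \<le> step_up B q n s" using le_step_up[OF s] by auto
qed

text \<open>Enlarging the count can only raise the level, but a level for \<open>s'\<close> at or
  above the old one would satisfy the constraint for \<open>s\<close> too, since the counts agree
  there. This is the leave-one-out step, with \<open>s'\<close> obtained by declaring one hypothesis
  rejected.\<close>

lemma step_up_eq_of_agree_above:
  assumes s: "mono_on {0..1} s" "\<And>\<alpha>. \<alpha> \<in> {0..1} \<Longrightarrow> s \<alpha> \<in> real ` {..n}"
    and s': "mono_on {0..1} s'" "\<And>\<alpha>. \<alpha> \<in> {0..1} \<Longrightarrow> s' \<alpha> \<in> real ` {..n}"
    and le: "\<And>\<alpha>. \<alpha> \<in> {0..1} \<Longrightarrow> s \<alpha> \<le> s' \<alpha>"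
    and agree: "\<And>\<alpha>. \<alpha> \<in> {0..1} \<Longrightarrow> step_up B q n s \<le> \<alpha> \<Longrightarrow> s \<alpha> = s' \<alpha>"
  shows "step_up B q n s' = step_up B q n s"
proof (rule antisym)
  let ?z = "step_up B q n s" and ?z' = "step_up B q n s'"
  have "0 \<le> s 0" "0 \<le> s' 0" using s(2)[of 0] s'(2)[of 0] by auto
  note z = step_up_mem[of s n, OF this(1)] and z' = step_up_mem[of s' n, OF this(2)]
  have *: "B ?z \<le> q * s' ?z"
    using z le[OF z(1)] q by (meson mult_left_mono order_trans)
  obtain k where "s' ?z = real k" "k \<le> n" using s'(2)[OF z(1)] by auto
  from le_step_up[OF s'(1) z(1) * this] show ge: "?z \<le> ?z'" .
  have *: "B ?z' \<le> q * s ?z'"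
    using z' agree[OF z'(1) ge] by simp
  obtain k where "s ?z' = real k" "k \<le> n" using s(2)[OF z'(1)] by auto
  from le_step_up[OF s(1) z'(1) * this] show "?z' \<le> ?z" .
qed

end

section \<open>Independence of one true null from all other paths\<close>

lemma measurable_path_component:
  assumes "j \<in> J" "c \<in> {0..1}"
  shows "(\<lambda>z. z j c) \<in> borel_measurable (\<Pi>\<^sub>M j\<in>J. path_space)"
proof -
  have "(\<lambda>v. v c) \<in> path_space \<rightarrow>\<^sub>M count_space {0, 1}"
    unfolding path_space_def using assms(2) by (rule measurable_component_singleton)
  moreover have "(\<lambda>r. r) \<in> count_space {0, 1 :: real} \<rightarrow>\<^sub>M borel"
    by simp
  ultimately have "(\<lambda>v. v c) \<in> borel_measurable path_space"
    by (rule measurable_compose)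
  with measurable_component_singleton[OF assms(1)] show ?thesis
    by (rule measurable_compose)
qed

text \<open>An instance of \<open>indep_var_combine\<close>: \<open>Z\<close> collects all null
  paths, restricted to \<open>{m}\<close> and to \<open>N0 - {m}\<close>, while \<open>V\<close>
  collects the paths in \<open>N1\<close>. Independence among the nulls and between the blocks gives
  the two premises.\<close>

lemma (in prob_space) indep_var_decision_others:
  assumes blocks: "indep_var (\<Pi>\<^sub>M m\<in>N0. path_space) (decision_paths \<delta> N0)
                             (\<Pi>\<^sub>M m\<in>N1. path_space) (decision_paths \<delta> N1)"
    and nulls: "indep_vars (\<lambda>m. path_space) (decision_path \<delta>) N0"
    and m: "m \<in> N0" and c: "c \<in> {0..1}"
    and H: "H \<in> borel_measurable ((\<Pi>\<^sub>M m\<in>N0-{m}. path_space) \<Otimes>\<^sub>M (\<Pi>\<^sub>M m\<in>N1. path_space))"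
  shows "indep_var borel (\<delta> m c)
    borel (\<lambda>x. H (decision_paths \<delta> (N0 - {m}) x, decision_paths \<delta> N1 x) :: real)"
proof -
  have eq: "restrict (decision_paths \<delta> N0 x) K = (\<lambda>i\<in>K. decision_path \<delta> i x)" if "K \<subseteq> N0" for K x
    using that by (auto simp: decision_paths_def restrict_def fun_eq_iff)
  have eq': "restrict (decision_paths \<delta> N0 x) (N0 - {m}) = decision_paths \<delta> (N0 - {m}) x" for x
    by (auto simp: decision_paths_def restrict_def fun_eq_iff)
  have "indep_var borel (\<lambda>x. (restrict (decision_paths \<delta> N0 x) {m}) m c)
    borel (\<lambda>x. H (restrict (decision_paths \<delta> N0 x) (N0 - {m}), decision_paths \<delta> N1 x))"
  proof (rule indep_var_combine[where F="\<lambda>z. z m c" and f="\<lambda>z. restrict z {m}"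
        and g="\<lambda>z. restrict z (N0 - {m})", OF _ blocks])
    show "indep_var (\<Pi>\<^sub>M m\<in>{m}. path_space) (\<lambda>x. restrict (decision_paths \<delta> N0 x) {m})
        (\<Pi>\<^sub>M m\<in>N0-{m}. path_space) (\<lambda>x. restrict (decision_paths \<delta> N0 x) (N0 - {m}))"
      using indep_var_restrict[OF nulls, of "{m}" "N0 - {m}"] m by (simp add: eq)
    show "(\<lambda>z. z m c) \<in> borel_measurable (\<Pi>\<^sub>M m\<in>{m}. path_space)"
      using c by (intro measurable_path_component) auto
  qed (use m H in \<open>auto intro!: measurable_restrict_subset\<close>)
  moreover have "restrict (decision_paths \<delta> N0 x) {m} m c = \<delta> m c x" for x
    using m c by (simp add: decision_paths_def decision_path_def)
  ultimately show ?thesis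
    by (simp only: eq')
qed

section \<open>The false discovery rate bound under one measure\<close>

text \<open>The random proportion is almost everywhere equal to a measurable \<open>F\<close>, and
  \<open>F\<close> is dominated by \<open>U\<close>, a sum of products of independent factors whose
  expectation can be computed at deterministic levels.\<close>

lemma (in prob_space) fdr_le:
  fixes A :: "'m \<Rightarrow> real \<Rightarrow> real" and \<delta> :: "'m \<Rightarrow> real \<Rightarrow> 'a \<Rightarrow> real"
  assumes fin: "finite J" and J: "J = N0 \<union> N1"
    and dec: "\<And>m \<alpha>. m \<in> J \<Longrightarrow> \<alpha> \<in> {0..1} \<Longrightarrow> \<delta> m \<alpha> \<in> M \<rightarrow>\<^sub>M count_space {0, 1}"
    and mono: "\<And>m. m \<in> J \<Longrightarrow> AE x in M. mono_on {0..1} (\<lambda>\<alpha>. \<delta> m \<alpha> x)"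
    and blocks: "indep_var (\<Pi>\<^sub>M m\<in>N0. path_space) (decision_paths \<delta> N0)
                             (\<Pi>\<^sub>M m\<in>N1. path_space) (decision_paths \<delta> N1)"
    and nulls: "indep_vars (\<lambda>m. path_space) (decision_path \<delta>) N0"
    and size: "\<And>m \<alpha>. m \<in> N0 \<Longrightarrow> \<alpha> \<in> {0..1} \<Longrightarrow> expectation (\<delta> m \<alpha>) = \<alpha>"
    and A_cont: "\<And>m. m \<in> J \<Longrightarrow> continuous_on {0..1} (A m)"
    and A_mono: "\<And>m. m \<in> J \<Longrightarrow> mono_on {0..1} (A m)"
    and A_01: "\<And>m. m \<in> J \<Longrightarrow> A m 0 = 0" "\<And>m \<alpha>. m \<in> J \<Longrightarrow> \<alpha> \<in> {0..1} \<Longrightarrow> A m \<alpha> \<in> {0..1}"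
    and A_le: "\<And>m \<alpha>. m \<in> N0 \<Longrightarrow> \<alpha> \<in> {0..1} \<Longrightarrow> real (card N0) * A m \<alpha> \<le> (\<Sum>j\<in>J. A j \<alpha>)"
    and q: "0 \<le> q"
  shows "integrable (completion M) (fdp_star A \<delta> J N0 q)"
    and "(\<integral>x. fdp_star A \<delta> J N0 q x \<partial>completion M) \<le> q"
proof -
  define B where "B \<alpha> = (\<Sum>j\<in>J. A j \<alpha>)" for \<alpha>
  define n where "n = card J"
  define S where "S x \<alpha> = rejections A \<delta> J \<alpha> x" for x \<alpha>
  \<comment> \<open>The path of \<open>m\<close> does not enter, and for \<open>m\<close> in
    \<open>J\<close> the value is at least 1 on the sample space, so division by it is safe.\<close>
  define R where "R m x \<alpha> = 1 + rejections A \<delta> (J - {m}) \<alpha> x" for m x \<alpha>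
  define Z where "Z x = step_up B q n (S x)" for x
  define Zm where "Zm m x = step_up B q n (R m x)" for m x
  define T where "T = insert 0 (crossing B q ` {..n})"
  \<comment> \<open>The reciprocal of \<open>R\<close> on the event that the leave-one-out size
    equals \<open>t\<close>. Splitting over \<open>t\<close> in \<open>T\<close> leaves \<delta>
    evaluated at the deterministic level \<open>A m t\<close>, where \<open>size\<close>
    applies.\<close>
  define W where "W m t x = of_bool (Zm m x = t) / R m x t" for m t x
  have B: "continuous_on {0..1} B" "B 0 = 0"
    unfolding B_def by (auto intro!: continuous_on_sum A_cont simp: A_01)
  have T: "finite T" "t \<in> {0..1}" if "t \<in> T" for t
    using that crossing_mem(1)[OF B q] by (auto simp: T_def)
  have finT: "finite T" by (simp add: T_def)
  have ZT: "Z x \<in> T" "Zm m x \<in> T" for x m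
    unfolding Z_def Zm_def T_def by (rule step_up_range)+
  have finN0: "finite N0" and N0J: "N0 \<subseteq> J" using fin J by auto
  have d01: "\<delta> m \<alpha> x \<in> {0, 1}" if "m \<in> J" "\<alpha> \<in> {0..1}" "x \<in> space M" for m \<alpha> x
    using measurable_space[OF dec[OF that(1,2)] that(3)] by simp
  have d_meas [measurable]: "\<delta> m \<alpha> \<in> borel_measurable M" if "m \<in> J" "\<alpha> \<in> {0..1}" for m \<alpha>
    by (rule measurable_compose[OF dec[OF that], of "\<lambda>r. r"]) simp
  have rej: "rejections A \<delta> K \<alpha> x \<in> real ` {..card K}" if "K \<subseteq> J" "\<alpha> \<in> {0..1}" "x \<in> space M" for K \<alpha> x
  proof -
    have finK: "finite K" using fin that finite_subset by blast
    have "\<delta> m (A m \<alpha>) x = of_bool (\<delta> m (A m \<alpha>) x = 1)" if "m \<in> K" for m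
      using d01[of m "A m \<alpha>" x] A_01(2)[of m \<alpha>] that \<open>K \<subseteq> J\<close> \<open>\<alpha> \<in> {0..1}\<close> \<open>x \<in> space M\<close> by auto
    then have "rejections A \<delta> K \<alpha> x = (\<Sum>m\<in>K. of_bool (\<delta> m (A m \<alpha>) x = 1))"
      unfolding rejections_def by (intro sum.cong refl)
    also have "\<dots> = real (card (K \<inter> {m. \<delta> m (A m \<alpha>) x = 1}))"
      using finK by simp
    finally show ?thesis using finK by (auto intro!: card_mono)
  qed
  have rej_meas: "(\<lambda>x. rejections A \<delta> K \<alpha> x) \<in> borel_measurable M" if "K \<subseteq> J" "\<alpha> \<in> {0..1}" for K \<alpha>
    unfolding rejections_def using that A_01(2) by (intro borel_measurable_sum d_meas) auto
  have S_nat: "S x \<alpha> \<in> real ` {..n}" if "x \<in> space M" "\<alpha> \<in> {0..1}" for x \<alpha>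
    unfolding S_def n_def using rej that by auto
  have R_nat: "R m x \<alpha> \<in> real ` {..n}" and R_ge: "1 \<le> R m x \<alpha>"
    if m: "m \<in> J" and x: "x \<in> space M" and \<alpha>: "\<alpha> \<in> {0..1}" for m x \<alpha>
  proof -
    obtain k where k: "rejections A \<delta> (J - {m}) \<alpha> x = real k" "k \<le> card (J - {m})"
      using rej[of "J - {m}" \<alpha> x, OF Diff_subset \<alpha> x] by (auto elim!: imageE)
    \<comment> \<open>Omitting \<open>m\<close> leaves at most \<open>n - 1\<close> rejections, so
      the added 1 does not exceed the range of \<open>step_up B q n\<close>.\<close>
    have "Suc k \<le> n" using k(2) m fin card_Suc_Diff1[of J m] unfolding n_def by linarith
    moreover have "R m x \<alpha> = real (Suc k)" by (simp add: R_def k)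
    ultimately show "R m x \<alpha> \<in> real ` {..n}" "1 \<le> R m x \<alpha>"
      by (auto simp del: of_nat_Suc)
  qed
  have S_eq: "S x \<alpha> = \<delta> m (A m \<alpha>) x + (R m x \<alpha> - 1)" if "m \<in> J" for m x \<alpha>
    unfolding S_def R_def rejections_def using that fin by (simp add: sum.remove[of J m])
  have S_meas: "(\<lambda>x. S x \<alpha>) \<in> borel_measurable M" if "\<alpha> \<in> {0..1}" for \<alpha>
    unfolding S_def using that by (intro rej_meas) auto
  have R_meas: "(\<lambda>x. R m x \<alpha>) \<in> borel_measurable M" if "\<alpha> \<in> {0..1}" for m \<alpha>
    unfolding R_def using that by (intro borel_measurable_add rej_meas) auto
  have Z_meas [measurable]: "Z \<in> borel_measurable M"
    unfolding Z_def using crossing_mem(1)[OF B q] by (intro measurable_step_up S_meas)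
  have Zm_meas [measurable]: "Zm m \<in> borel_measurable M" for m
    unfolding Zm_def using crossing_mem(1)[OF B q] by (intro measurable_step_up R_meas)
  have W_meas: "W m t \<in> borel_measurable M" if "t \<in> T" for m t
  proof -
    note [measurable] = R_meas[OF T(2)[OF that]]
    show ?thesis unfolding W_def by measurable
  qed
  have W_01: "0 \<le> W m t x" "W m t x \<le> 1" if "m \<in> J" "t \<in> T" "x \<in> space M" for m t x
    using R_ge[OF that(1,3) T(2)[OF that(2)]] by (auto simp: W_def divide_simps)
  \<comment> \<open>Summing over deterministic levels makes \<open>F\<close> measurable on the whole
    space; only the term with \<open>t = Z x\<close> survives.\<close>
  define F where "F x = (\<Sum>t\<in>T. of_bool (Z x = t) * false_discovery_prop A \<delta> J N0 t x)" for x
  define U where "U x = (\<Sum>m\<in>N0. \<Sum>t\<in>T. \<delta> m (A m t) x * W m t x)" for x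
  have F_eq: "F x = false_discovery_prop A \<delta> J N0 (Z x) x" for x
    unfolding F_def using ZT(1) finT by (simp add: of_bool_def if_distrib[of "\<lambda>r. r * _"] sum.delta cong: if_cong)
  have F_meas: "F \<in> borel_measurable M"
  proof -
    have "(\<lambda>x. of_bool (Z x = t) * false_discovery_prop A \<delta> J N0 t x) \<in> borel_measurable M" if "t \<in> T" for t
    proof -
      note [measurable] = rej_meas[OF order.refl T(2)[OF that]] rej_meas[OF N0J T(2)[OF that]]
      show ?thesis unfolding false_discovery_prop_def by measurable
    qed
    then show ?thesis unfolding F_def by (rule borel_measurable_sum)
  qed
  have ae_mono: "AE x in M. \<forall>m\<in>J. mono_on {0..1} (\<lambda>\<alpha>. \<delta> m \<alpha> x)"
    using fin mono by (intro AE_finite_allI)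
  have rej_mono: "mono_on {0..1} (\<lambda>\<alpha>. rejections A \<delta> K \<alpha> x)"
    if "K \<subseteq> J" and x: "\<forall>m\<in>J. mono_on {0..1} (\<lambda>\<alpha>. \<delta> m \<alpha> x)" for K x
    unfolding rejections_def
  proof (intro mono_onI sum_mono)
    fix r s :: real and m assume rs: "r \<in> {0..1}" "s \<in> {0..1}" "r \<le> s" and "m \<in> K"
    then have m: "m \<in> J" using that by auto
    have "A m r \<le> A m s" using mono_onD[OF A_mono[OF m] rs] .
    then show "\<delta> m (A m r) x \<le> \<delta> m (A m s) x"
      using mono_onD[OF x[rule_format, OF m]] A_01(2)[OF m] rs by blast
  qed
  have pointwise: "fdp_star A \<delta> J N0 q x = F x" "0 \<le> F x" "F x \<le> U x"
    if x: "x \<in> space M" and mx: "\<forall>m\<in>J. mono_on {0..1} (\<lambda>\<alpha>. \<delta> m \<alpha> x)" for x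
  proof -
    let ?z = "Z x"
    have z: "?z \<in> {0..1}" using T(2)[OF ZT(1)] .
    have Sm: "mono_on {0..1} (S x)"
      unfolding S_def by (rule rej_mono[OF order.refl mx])
    have Rm: "mono_on {0..1} (R m x)" for m
      unfolding R_def using rej_mono[of "J - {m}", OF _ mx] by (auto simp: mono_on_def)
    have "alpha_star A \<delta> J q x = ?z"
      unfolding alpha_star_def Z_def
      using Sup_eq_step_up[OF B q Sm S_nat[OF x]] by (simp only: B_def[symmetric] S_def[symmetric])
    then show "fdp_star A \<delta> J N0 q x = F x"
      by (simp add: fdp_star_def F_eq)
    have Sz: "0 \<le> S x ?z" using S_nat[OF x z] by auto
    have d_nonneg: "0 \<le> \<delta> m (A m t) x" if "m \<in> N0" "t \<in> {0..1}" for m t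
    proof -
      have "m \<in> J" using that N0J by auto
      from d01[OF this A_01(2)[OF this that(2)] x] show ?thesis by auto
    qed
    have F_sum: "F x = (\<Sum>m\<in>N0. \<delta> m (A m ?z) x / S x ?z)"
      unfolding F_eq false_discovery_prop_def S_def[symmetric] using Sz
      by (auto simp: rejections_def sum_divide_distrib less_le)
    show "0 \<le> F x"
      unfolding F_sum using Sz d_nonneg z by (intro sum_nonneg divide_nonneg_nonneg)
    show "F x \<le> U x"
      unfolding F_sum U_def
    proof (rule sum_mono)
      fix m assume m: "m \<in> N0"
      then have mJ: "m \<in> J" using N0J by auto
      have nonneg: "0 \<le> \<delta> m (A m t) x * W m t x" if "t \<in> T" for t
        using d_nonneg[OF m T(2)[OF that]] W_01[OF mJ that x] by simp
      consider "\<delta> m (A m ?z) x = 0" | "\<delta> m (A m ?z) x = 1"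
        using d01[OF mJ A_01(2)[OF mJ z] x] by auto
      then show "\<delta> m (A m ?z) x / S x ?z \<le> (\<Sum>t\<in>T. \<delta> m (A m t) x * W m t x)"
      proof cases
        case 1
        then show ?thesis using nonneg by (simp add: sum_nonneg)
      next
        case 2
        \<comment> \<open>A rejection at \<open>?z\<close> persists at every higher level, as
          \<open>A m\<close> and the path are monotone; replacing the decision by 1 then changes
          nothing.\<close>
        have agree: "S x \<alpha> = R m x \<alpha>" if \<alpha>: "\<alpha> \<in> {0..1}" "?z \<le> \<alpha>" for \<alpha>
        proof -
          have "A m ?z \<le> A m \<alpha>" using mono_onD[OF A_mono[OF mJ] z \<alpha>] .
          then have "1 \<le> \<delta> m (A m \<alpha>) x"
            using mono_onD[OF mx[rule_format, OF mJ], of "A m ?z" "A m \<alpha>"] A_01(2)[OF mJ] z \<alpha> 2 by simp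
          then have "\<delta> m (A m \<alpha>) x = 1" using d01[OF mJ A_01(2)[OF mJ \<alpha>(1)] x] by auto
          then show ?thesis using S_eq[OF mJ, of x \<alpha>] by simp
        qed
        have le: "S x \<alpha> \<le> R m x \<alpha>" if "\<alpha> \<in> {0..1}" for \<alpha>
          using d01[OF mJ A_01(2)[OF mJ that] x] S_eq[OF mJ, of x \<alpha>] by auto
        have "Zm m x = ?z"
          unfolding Zm_def Z_def
          by (rule step_up_eq_of_agree_above[OF B q Sm S_nat[OF x] Rm R_nat[OF mJ x] le])
             (auto simp: agree Z_def)
        then have "\<delta> m (A m ?z) x / S x ?z = \<delta> m (A m ?z) x * W m ?z x"
          using agree[OF z] by (simp add: W_def)
        also have "\<dots> \<le> (\<Sum>t\<in>T. \<delta> m (A m t) x * W m t x)"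
          by (rule member_le_sum[where f="\<lambda>t. \<delta> m (A m t) x * W m t x"]) (use ZT nonneg finT in auto)
        finally show ?thesis .
      qed
    qed
  qed
  have int_W: "integrable M (W m t)" if "m \<in> J" "t \<in> T" for m t
  proof (rule integrable_const_bound[of _ 1])
    show "AE x in M. norm (W m t x) \<le> 1"
      using AE_space by eventually_elim (use W_01[OF that] in simp)
  qed (rule W_meas[OF that(2)])
  have int_d: "integrable M (\<delta> m \<alpha>)" if "m \<in> J" "\<alpha> \<in> {0..1}" for m \<alpha>
  proof (rule integrable_const_bound[of _ 1])
    show "AE x in M. norm (\<delta> m \<alpha> x) \<le> 1"
      using AE_space by eventually_elim (use d01[OF that] in force)
  qed (rule d_meas[OF that])
  have indep: "indep_var borel (\<delta> m (A m t)) borel (W m t)" if m: "m \<in> N0" and t: "t \<in> T" for m t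
  proof -
    \<comment> \<open>\<open>V\<close> reads the path of \<open>j\<close> from the block containing
      it, so that \<open>H\<close> exhibits \<open>W m t\<close> as a measurable function of the
      pair of blocks \<open>N0 - {m}\<close> and \<open>N1\<close>.\<close>
    define V where "V p j \<alpha> = (if j \<in> N0 then fst p j \<alpha> else snd p j \<alpha>)"
      for p :: "('m \<Rightarrow> real \<Rightarrow> real) \<times> ('m \<Rightarrow> real \<Rightarrow> real)" and j \<alpha>
    define Q where "Q p \<alpha> = 1 + (\<Sum>j\<in>J-{m}. V p j (A j \<alpha>))" for p \<alpha>
    define H where "H p = of_bool (step_up B q n (Q p) = t) / Q p t" for p
    let ?N = "(\<Pi>\<^sub>M m\<in>N0-{m}. path_space) \<Otimes>\<^sub>M (\<Pi>\<^sub>M m\<in>N1. path_space)"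
    have V_meas: "(\<lambda>p. V p j c) \<in> borel_measurable ?N" if "j \<in> J - {m}" "c \<in> {0..1}" for j c
    proof (cases "j \<in> N0")
      case True
      then have "j \<in> N0 - {m}" using that by auto
      from measurable_compose[OF measurable_fst measurable_path_component[OF this that(2)]]
      show ?thesis using True by (simp add: V_def)
    next
      case False
      then have "j \<in> N1" using that J by auto
      from measurable_compose[OF measurable_snd measurable_path_component[OF this that(2)]]
      show ?thesis using False by (simp add: V_def)
    qed
    have Q_meas: "(\<lambda>p. Q p \<alpha>) \<in> borel_measurable ?N" if "\<alpha> \<in> {0..1}" for \<alpha>
      unfolding Q_def using that A_01(2)
      by (intro borel_measurable_add borel_measurable_sum V_meas) auto
    have H_meas: "H \<in> borel_measurable ?N"
    proof -
      note [measurable] = Q_meas[OF T(2)[OF t]]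
      have [measurable]: "(\<lambda>p. step_up B q n (Q p)) \<in> borel_measurable ?N"
        using crossing_mem(1)[OF B q] by (intro measurable_step_up Q_meas)
      show ?thesis unfolding H_def by measurable
    qed
    have "H (decision_paths \<delta> (N0 - {m}) x, decision_paths \<delta> N1 x) = W m t x" for x
    proof -
      let ?p = "(decision_paths \<delta> (N0 - {m}) x, decision_paths \<delta> N1 x)"
      have Q: "Q ?p \<alpha> = R m x \<alpha>" if "\<alpha> \<in> {0..1}" for \<alpha>
        unfolding Q_def R_def rejections_def using that A_01(2) J
        by (intro arg_cong2[of _ _ _ _ "(+)"] refl sum.cong)
           (auto simp: V_def decision_paths_def decision_path_def)
      have "step_up B q n (Q ?p) = Zm m x"
        unfolding Zm_def by (rule step_up_cong[OF B q Q])
      then show ?thesis by (simp add: H_def W_def Q[OF T(2)[OF t]])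
    qed
    moreover have "A m t \<in> {0..1}"
      using m N0J A_01(2) T(2)[OF t] by blast
    ultimately show ?thesis
      using indep_var_decision_others[OF blocks nulls m _ H_meas, of "A m t"] by simp
  qed
  have int_prod: "integrable M (\<lambda>x. \<delta> m (A m t) x * W m t x)"
    and E_prod: "expectation (\<lambda>x. \<delta> m (A m t) x * W m t x) = A m t * expectation (W m t)"
    if "m \<in> N0" "t \<in> T" for m t
  proof -
    have m: "m \<in> J" and At: "A m t \<in> {0..1}" using that N0J A_01(2) T(2) by auto
    note * = indep[OF that] int_d[OF m At] int_W[OF m that(2)]
    show "integrable M (\<lambda>x. \<delta> m (A m t) x * W m t x)"
      using * by (rule indep_var_integrable)
    show "expectation (\<lambda>x. \<delta> m (A m t) x * W m t x) = A m t * expectation (W m t)"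
      using indep_var_lebesgue_integral[OF *] size[OF that(1) At] by simp
  qed
  have bound: "(\<Sum>t\<in>T. A m t * W m t x) \<le> q / card N0" if m: "m \<in> N0" and x: "x \<in> space M" for m x
  proof -
    let ?z = "Zm m x"
    have mJ: "m \<in> J" using m N0J by auto
    have z: "?z \<in> {0..1}" using T(2)[OF ZT(2)] .
    have R1: "1 \<le> R m x \<alpha>" if "\<alpha> \<in> {0..1}" for \<alpha> using R_ge[OF mJ x that] .
    have "0 \<le> R m x 0" using R1[of 0] by simp
    \<comment> \<open>The leave-one-out size satisfies its own constraint; chained with
      \<open>A_le\<close> this gives
      \<open>card N0 * A m ?z \<le> B ?z \<le> q * R m x ?z\<close>.\<close>
    from step_up_mem(2)[of B q "R m x" n, OF B q this] have "B ?z \<le> q * R m x ?z" by (simp add: Zm_def)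
    with A_le[OF m z] have "card N0 * A m ?z \<le> q * R m x ?z" by (simp add: B_def)
    moreover have "0 < card N0" using m finN0 by (auto simp: card_gt_0_iff)
    ultimately have "A m ?z / R m x ?z \<le> q / card N0"
      using R1[OF z] by (simp add: field_simps)
    moreover have "(\<Sum>t\<in>T. A m t * W m t x) = (\<Sum>t\<in>T. if t = ?z then A m t / R m x t else 0)"
      by (intro sum.cong) (auto simp: W_def)
    ultimately show ?thesis using ZT(2) finT by (simp add: sum.delta')
  qed
  have int_U: "integrable M U"
    unfolding U_def by (intro Bochner_Integration.integrable_sum int_prod)
  have "expectation U = (\<Sum>m\<in>N0. \<Sum>t\<in>T. A m t * expectation (W m t))"
    unfolding U_def by (simp add: int_prod E_prod)
  also have "\<dots> = (\<Sum>m\<in>N0. expectation (\<lambda>x. \<Sum>t\<in>T. A m t * W m t x))"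
    using N0J by (intro sum.cong refl) (auto simp: int_W subset_eq)
  also have "\<dots> \<le> (\<Sum>m\<in>N0. q / card N0)"
  proof (rule sum_mono)
    fix m assume m: "m \<in> N0"
    then have "m \<in> J" using N0J by auto
    then have "integrable M (\<lambda>x. \<Sum>t\<in>T. A m t * W m t x)"
      by (intro Bochner_Integration.integrable_sum integrable_mult_right int_W)
    then have "expectation (\<lambda>x. \<Sum>t\<in>T. A m t * W m t x) \<le> expectation (\<lambda>x. q / card N0)"
      by (rule integral_mono) (use bound[OF m] in auto)
    then show "expectation (\<lambda>x. \<Sum>t\<in>T. A m t * W m t x) \<le> q / card N0"
      by (simp add: prob_space)
  qed
  \<comment> \<open>Equality holds unless \<open>N0\<close> is empty, in which case the sum is
    0.\<close>
  also have "\<dots> \<le> q" using q by simp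
  finally have E_U: "expectation U \<le> q" .
  have ae: "AE x in M. fdp_star A \<delta> J N0 q x = F x \<and> 0 \<le> F x \<and> F x \<le> U x"
    using ae_mono AE_space by eventually_elim (use pointwise in blast)
  have int_F: "integrable M F"
    by (rule Bochner_Integration.integrable_bound[OF int_U F_meas]) (use ae in eventually_elim, auto)
  have E_F: "expectation F \<le> q"
  proof -
    have "expectation F \<le> expectation U"
      by (rule integral_mono_AE[OF int_F int_U]) (use ae in eventually_elim, simp)
    then show ?thesis using E_U by simp
  qed
  \<comment> \<open>Passing to the completion turns almost everywhere equality with \<open>F\<close>
    into measurability of \<open>fdp_star\<close>, and the integrals coincide.\<close>
  have ae': "AE x in completion M. F x = fdp_star A \<delta> J N0 q x"
    by (rule AE_completion) (use ae in eventually_elim, auto)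
  have F_c: "F \<in> borel_measurable (completion M)"
    using F_meas by (rule measurable_completion)
  have f_c: "fdp_star A \<delta> J N0 q \<in> borel_measurable (completion M)"
    by (rule complete_measure.measurable_cong_AE[OF completion.complete_measure_axioms F_c _ ae']) auto
  show "integrable (completion M) (fdp_star A \<delta> J N0 q)"
    using integrable_cong_AE[OF F_c f_c ae'] integrable_completion[OF F_meas] int_F by simp
  show "(\<integral>x. fdp_star A \<delta> J N0 q x \<partial>completion M) \<le> q"
    using integral_cong_AE[OF F_c f_c ae'] integral_completion[OF F_meas] E_F by simp
qed

section \<open>Transfer to every measure of the model\<close>

theorem theorem3p2:
  fixes X :: "'x measure" and \<P> :: "'x measure set"
    and M :: "'m set" and M0 M1 :: "'x measure \<Rightarrow> 'm set"
    and \<delta> :: "'m \<Rightarrow> real \<Rightarrow> 'x \<Rightarrow> real" and A :: "'m \<Rightarrow> real \<Rightarrow> real"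
  assumes model: "\<And>P. P \<in> \<P> \<Longrightarrow> prob_space P \<and> sets P = sets X"
    and finite_M: "finite M"
    and partition: "\<And>P. P \<in> \<P> \<Longrightarrow> M0 P \<inter> M1 P = {} \<and> M0 P \<union> M1 P = M"
    and decision: "\<And>m \<alpha>. m \<in> M \<Longrightarrow> \<alpha> \<in> {0..1} \<Longrightarrow> \<delta> m \<alpha> \<in> X \<rightarrow>\<^sub>M count_space {0, 1}"
    and D1: "\<And>m P. m \<in> M \<Longrightarrow> P \<in> \<P> \<Longrightarrow> AE x in P. \<delta> m 0 x = 0 \<and> \<delta> m 1 x = 1"
    and D2: "\<And>m P. m \<in> M \<Longrightarrow> P \<in> \<P> \<Longrightarrow> AE x in P.
          (\<forall>\<alpha>\<in>{0..1}. \<delta> m \<alpha> x \<in> {0, 1})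
        \<and> step_on_unit (\<lambda>\<alpha>. \<delta> m \<alpha> x)
        \<and> mono_on {0..1} (\<lambda>\<alpha>. \<delta> m \<alpha> x)
        \<and> (\<forall>\<alpha>\<in>{0..<1}. continuous (at_right \<alpha>) (\<lambda>\<alpha>. \<delta> m \<alpha> x))"
    and D3_blocks: "\<And>P. P \<in> \<P> \<Longrightarrow> prob_space.indep_var P
          (\<Pi>\<^sub>M m\<in>M0 P. path_space) (decision_paths \<delta> (M0 P))
          (\<Pi>\<^sub>M m\<in>M1 P. path_space) (decision_paths \<delta> (M1 P))"
    and D3_nulls: "\<And>P. P \<in> \<P> \<Longrightarrow>
          prob_space.indep_vars P (\<lambda>m. path_space) (decision_path \<delta>) (M0 P)"
    and D4: "\<And>P m \<alpha>. P \<in> \<P> \<Longrightarrow> m \<in> M0 P \<Longrightarrow> \<alpha> \<in> {0..1} \<Longrightarrow> (\<integral>x. \<delta> m \<alpha> x \<partial>P) = \<alpha>"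
    and A_measurable: "\<And>m. m \<in> M \<Longrightarrow>
          A m \<in> restrict_space borel {0..1} \<rightarrow>\<^sub>M restrict_space borel {0..1}"
    and A1: "\<And>m. m \<in> M \<Longrightarrow> A m 0 = 0 \<and> A m 1 = 1"
    and A2: "\<And>m. m \<in> M \<Longrightarrow> continuous_on {0..1} (A m) \<and> strict_mono_on {0..1} (A m)"
    and A3: "\<And>\<alpha>. \<alpha> \<in> {0..1} \<Longrightarrow> (\<Prod>m\<in>M. 1 - A m \<alpha>) \<ge> 1 - \<alpha>"
    and A4: "\<And>\<alpha> P. \<alpha> \<in> {0..1} \<Longrightarrow> P \<in> \<P> \<Longrightarrow>
          (if M0 P = {} then 0 else real (card (M0 P)) * (MAX m\<in>M0 P. A m \<alpha>)) \<le> (\<Sum>m\<in>M. A m \<alpha>)"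
    and distinct_pvalues: "\<And>P. P \<in> \<P> \<Longrightarrow>
          AE x in P. \<forall>m\<in>M. \<forall>n\<in>M. m \<noteq> n \<longrightarrow> pvalue A \<delta> m x \<noteq> pvalue A \<delta> n x"
  shows "\<forall>P\<in>\<P>. \<forall>q\<in>{0..1}.
          integrable (completion P) (fdp_star A \<delta> M (M0 P) q)
        \<and> (\<integral>x. fdp_star A \<delta> M (M0 P) q x \<partial>completion P) \<le> q"
proof (intro ballI)
  fix P q assume P: "P \<in> \<P>" and q: "q \<in> {0..1::real}"
  interpret prob_space P using model[OF P] by simp
  have sets_P: "sets P = sets X" using model[OF P] by simp
  have M: "M = M0 P \<union> M1 P" using partition[OF P] by simp
  have mono: "AE x in P. mono_on {0..1} (\<lambda>\<alpha>. \<delta> m \<alpha> x)" if "m \<in> M" for m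
    using D2[OF that P] by eventually_elim simp
  have A_mono: "mono_on {0..1} (A m)" if "m \<in> M" for m
    using A2[OF that] by (simp add: strict_mono_on_imp_mono_on)
  \<comment> \<open>The bounds on the values come from the target space in
    \<open>A_measurable\<close>.\<close>
  have A_range: "A m \<alpha> \<in> {0..1}" if "m \<in> M" "\<alpha> \<in> {0..1}" for m \<alpha>
    using measurable_space[OF A_measurable[OF that(1)], of \<alpha>] that(2)
    by (simp add: space_restrict_space)
  have dec: "\<delta> m \<alpha> \<in> P \<rightarrow>\<^sub>M count_space {0, 1}" if "m \<in> M" "\<alpha> \<in> {0..1}" for m \<alpha>
    using decision[OF that] by (simp add: measurable_cong_sets[OF sets_P refl])
  have A_le: "real (card (M0 P)) * A m \<alpha> \<le> (\<Sum>j\<in>M. A j \<alpha>)"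
    if m: "m \<in> M0 P" and \<alpha>: "\<alpha> \<in> {0..1}" for m \<alpha>
  proof -
    have "A m \<alpha> \<le> (MAX m\<in>M0 P. A m \<alpha>)"
      using m finite_M M by (intro Max_ge) auto
    then have "real (card (M0 P)) * A m \<alpha> \<le> real (card (M0 P)) * (MAX m\<in>M0 P. A m \<alpha>)"
      by (rule mult_left_mono) simp
    also have "\<dots> \<le> (\<Sum>j\<in>M. A j \<alpha>)"
      \<comment> \<open>Membership of \<open>m\<close> rules out the empty case of (A4).\<close>
      using A4[OF \<alpha> P] m by (auto split: if_splits)
    finally show ?thesis .
  qed
  show "integrable (completion P) (fdp_star A \<delta> M (M0 P) q)
      \<and> (\<integral>x. fdp_star A \<delta> M (M0 P) q x \<partial>completion P) \<le> q"
    using fdr_le[OF finite_M M dec mono D3_blocks[OF P] D3_nulls[OF P] D4[OF P] _ A_mono _ A_range A_le, of q]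
      A1 A2 q by auto
qed

end
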